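(* Let $0<q<1$. The function $f_q(s,t)$, defined for $s\in\mathbf{C}$ and $\mathrm{Re}(t)>0$ by $$f_q(s,t)=\sum_{n=1}^\infty\frac{q^{nt}}{[n]_q^s},$$ is continued meromorphically, as a function of $(s,t)\in\mathbf{C}^2$, via the series expansion $$f_q(s,t)=(1-q)^s\sum_{r=0}^\infty\binom{s+r-1}{r}\frac{q^{t+r}}{1-q^{t+r}},$$ and this meromorphic function on $\mathbf{C}^2$ has poles of order $1$ at (i.e. along the hyperplanes given by) $$t\in\mathbf{Z}_{\le0}+\frac{2\pi i\,\mathbf{Z}}{\log q}:=\left\{a+\frac{2\pi i b}{\log q}\ \middle|\ a,b\in\mathbf{Z},\ a\le0\right\}.$$
   Context: For $0<q<1$ and an integer $n\ge1$, $[n]_q=(1-q^n)/(1-q)>0$. Powers of positive reals are $x^s=e^{s\log x}$ with real logarithm. The binomial coefficient is $\binom{s+r-1}{r}=\frac{s(s+1)\cdots(s+r-1)}{r!}$ (equal to $1$ for $r=0$). The defining series of $f_q(s,t)$ converges absolutely for all $s\in\mathbf{C}$ and $\mathrm{Re}(t)>0$. The statement about poles concerns $f_q$ as a meromorphic function of the two variables $(s,t)$, the hyperplanes $\{(s,t): t=a+2\pi i b/\log q\}$ being the components of its pole divisor; for special values of $s$ (non-positive integers) some coefficients $\binom{s+r-1}{r}$ vanish. *)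

theory Defs
  imports "HOL-Complex_Analysis.Complex_Analysis"
begin

text \<open>
  Holomorphy in two variables, for use on open sets: complex (Frechet) differentiability.
  The maps \<open>(u, v) \<mapsto> a * u + b * v\<close> are exactly the complex-linear ones.
\<close>

definition holomorphic2_on :: "(complex \<times> complex \<Rightarrow> complex) \<Rightarrow> (complex \<times> complex) set \<Rightarrow> bool"
    (infixl "holomorphic2'_on" 50) where
  "F holomorphic2_on U \<longleftrightarrow>
     (\<forall>p\<in>U. \<exists>a b. (F has_derivative (\<lambda>(u, v). a * u + b * v)) (at p))"

text \<open>
  Locally a quotient of holomorphic functions whose denominator is not identically zero.
  As for the one-variable \<open>meromorphic_on\<close>, functions are total, and the values on the
  zero set of the denominator are not constrained.
\<close>

definition meromorphic2_on :: "(complex \<times> complex \<Rightarrow> complex) \<Rightarrow> (complex \<times> complex) set \<Rightarrow> bool"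
    (infixl "meromorphic2'_on" 50) where
  "F meromorphic2_on U \<longleftrightarrow>
     (\<forall>p\<in>U. \<exists>V g h. open V \<and> connected V \<and> p \<in> V \<and> V \<subseteq> U \<and>
        g holomorphic2_on V \<and> h holomorphic2_on V \<and> (\<exists>z\<in>V. h z \<noteq> 0) \<and>
        (\<forall>z\<in>V. h z \<noteq> 0 \<longrightarrow> F z = g z / h z))"

text \<open>
  Pole of order \<open>k\<close> along the hyperplane \<open>H = {(s, t). t = c}\<close>: near every point of \<open>H\<close>,
  \<open>F = (t - c)\<^sup>-\<^sup>k g / h\<close> with \<open>g\<close>, \<open>h\<close> holomorphic and neither of them vanishing identically on \<open>H\<close>,
  i.e. neither divisible by the local equation \<open>t - c\<close>. The numerator \<open>g\<close> may still vanish at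
  individual points of \<open>H\<close>.
\<close>

definition pole_of_order_along ::
    "(complex \<times> complex \<Rightarrow> complex) \<Rightarrow> complex \<Rightarrow> nat \<Rightarrow> bool" where
  "pole_of_order_along F c k \<longleftrightarrow>
     (\<forall>s0. \<exists>e>0. \<exists>g h.
        g holomorphic2_on (ball s0 e \<times> ball c e) \<and>
        h holomorphic2_on (ball s0 e \<times> ball c e) \<and>
        (\<exists>s\<in>ball s0 e. g (s, c) \<noteq> 0) \<and> (\<exists>s\<in>ball s0 e. h (s, c) \<noteq> 0) \<and>
        (\<forall>s\<in>ball s0 e. \<forall>t\<in>ball c e. t \<noteq> c \<longrightarrow> h (s, t) \<noteq> 0 \<longrightarrow>
           F (s, t) = g (s, t) / ((t - c) ^ k * h (s, t))))"

definition q_bracket :: "real \<Rightarrow> nat \<Rightarrow> real" where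
  "q_bracket q n = (1 - q ^ n) / (1 - q)"

definition fq_term :: "real \<Rightarrow> complex \<Rightarrow> complex \<Rightarrow> nat \<Rightarrow> complex" where
  "fq_term q s t n =
     complex_of_real q powr (of_nat n * t) / complex_of_real (q_bracket q n) powr s"

text \<open>The sum starts at \<open>n = 1\<close>.\<close>

definition fq :: "real \<Rightarrow> complex \<Rightarrow> complex \<Rightarrow> complex" where
  "fq q s t = (\<Sum>n. fq_term q s t (Suc n))"

text \<open>
  If \<open>q\<^sup>t\<^sup>+\<^sup>r = 1\<close> the term below is \<open>0\<close> by the convention \<open>x / 0 = 0\<close>; this only
  affects values on the polar hyperplanes.
\<close>

definition fq_cont_term :: "real \<Rightarrow> complex \<Rightarrow> complex \<Rightarrow> nat \<Rightarrow> complex" where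
  "fq_cont_term q s t r =
     ((s + of_nat r - 1) gchoose r) *
     (complex_of_real q powr (t + of_nat r) / (1 - complex_of_real q powr (t + of_nat r)))"

definition fq_cont :: "real \<Rightarrow> complex \<times> complex \<Rightarrow> complex" where
  "fq_cont q = (\<lambda>(s, t). complex_of_real (1 - q) powr s * (\<Sum>r. fq_cont_term q s t r))"

definition fq_poles :: "real \<Rightarrow> complex set" where
  "fq_poles q =
     {of_int a + 2 * of_real pi * \<i> * of_int b / of_real (ln q) | a b :: int. a \<le> 0}"

end

theory Submission
  imports Defs
begin

text \<open>
  For \<open>Re t > 0\<close>, expanding \<open>(1 - q\<^sup>n)\<^sup>-\<^sup>s\<close> by the binomial series and summing the geometric series in \<open>n\<close>
  first turns the defining series into the continued one; the double series converges absolutely.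
  On bounded sets the terms of the continued series are eventually dominated by
  \<open>C (S + r - 1 choose r) q\<^sup>r\<close>, and near a given \<open>t\<^sub>0\<close> at most one index \<open>r\<^sub>0\<close> has a singular term.
  The remaining terms add up to a holomorphic function, so all statements about
  holomorphy and poles are read off the single term \<open>r\<^sub>0\<close>.
\<close>

section \<open>Holomorphy in two variables and dominated series of products\<close>

text \<open>Total differentiability follows from differentiability in one variable at the point plus
  a jointly continuous partial derivative in the other. With this asymmetric criterion, only the
  series of \<open>t\<close>-derivatives has to be controlled jointly in both variables.\<close>

lemma holomorphic2_on_partialsI:
  fixes f f' :: "complex \<Rightarrow> complex \<Rightarrow> complex"
  assumes "open A" "open B"
    and f1: "\<And>t. t \<in> B \<Longrightarrow> (\<lambda>s. f s t) holomorphic_on A"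
    and f2: "\<And>s t. s \<in> A \<Longrightarrow> t \<in> B \<Longrightarrow> (f s has_field_derivative f' s t) (at t)"
    and cont: "continuous_on (A \<times> B) (\<lambda>(s, t). f' s t)"
  shows "(\<lambda>(s, t). f s t) holomorphic2_on A \<times> B"
  unfolding holomorphic2_on_def
proof
  fix p assume "p \<in> A \<times> B"
  then obtain s t where p: "p = (s, t)" "s \<in> A" "t \<in> B" by auto
  \<comment> \<open>The criterion from partial derivatives wants a convex second factor, so
    \<open>B\<close> is shrunk to a ball.\<close>
  obtain d where d: "d > 0" "ball t d \<subseteq> B"
    using \<open>open B\<close> p openE by blast
  obtain D where D: "((\<lambda>s. f s t) has_field_derivative D) (at s)"
    using f1[OF p(3)] p(2) \<open>open A\<close>
    by (meson field_differentiable_def holomorphic_on_imp_differentiable_at)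
  have sub: "A \<times> ball t d \<subseteq> A \<times> B" using d by auto
  have "((\<lambda>(s, t). f s t) has_derivative
      (\<lambda>(u, v). D * u + blinfun_apply (blinfun_mult_right (f' s t)) v)) (at (s, t) within A \<times> ball t d)"
  proof (rule has_derivative_partialsI)
    show "((\<lambda>s. f s t) has_derivative (*) D) (at s within A)"
      using D has_field_derivative_at_within has_field_derivative_def by blast
    show "(f s has_derivative blinfun_apply (blinfun_mult_right (f' s y))) (at y within ball t d)"
      if "s \<in> A" "y \<in> ball t d" for s y
      using f2[of s y] that d
      by (simp add: has_derivative_at_withinI has_field_derivative_imp_has_derivative subset_iff)
    show "continuous (at (s, t) within A \<times> ball t d) (\<lambda>(x, y). blinfun_mult_right (f' x y))"
    proof -
      have "continuous_on (A \<times> ball t d) (\<lambda>p. blinfun_mult_right ((\<lambda>(s, t). f' s t) p))"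
        by (intro bounded_linear.continuous_on[OF bounded_linear_blinfun_mult_right]
            continuous_on_subset[OF cont sub])
      then show ?thesis
        using p d by (auto simp: continuous_on_eq_continuous_within case_prod_unfold)
    qed
  qed (use d in auto)
  moreover have "at (s, t) within A \<times> ball t d = at (s, t)"
    using p d \<open>open A\<close> by (intro at_within_open open_Times) auto
  ultimately show "\<exists>a b. ((\<lambda>(s, t). f s t) has_derivative (\<lambda>(u, v). a * u + b * v)) (at p)"
    unfolding p by auto
qed

text \<open>Domination allows termwise differentiation in each variable separately. Cauchy's
  inequality turns the same majorant into one for the \<open>t\<close>-derivatives, so by the M-test
  their sum is jointly continuous.\<close>

lemma holomorphic2_on_suminf:
  fixes a b :: "nat \<Rightarrow> complex \<Rightarrow> complex"
  assumes "open A" "open B"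
    and a: "\<And>n. a n holomorphic_on A" and b: "\<And>n. b n holomorphic_on B"
    and bound: "\<forall>\<^sub>F n in sequentially. \<forall>s\<in>A. \<forall>t\<in>B. norm (a n s * b n t) \<le> M n"
    and M: "summable M"
  shows "(\<lambda>(s, t). \<Sum>n. a n s * b n t) holomorphic2_on A \<times> B"
proof -
  define f' where "f' s t = (\<Sum>n. a n s * deriv (b n) t)" for s t
  \<comment> \<open>The doubled radius leaves a closed disc of radius \<open>d\<close> inside
    \<open>B\<close> around every point of the inner ball. Cauchy's inequality on its boundary
    circle then costs only the uniform factor \<open>1 / d\<close>.\<close>
  have "(\<lambda>(s, t). \<Sum>n. a n s * b n t) holomorphic2_on A \<times> ball t0 d"
    if d: "d > 0" "ball t0 (2 * d) \<subseteq> B" for t0 d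
  proof (rule holomorphic2_on_partialsI)
    have sub: "ball t0 d \<subseteq> B" using d by (force simp: subset_iff)
    show "(\<lambda>s. \<Sum>n. a n s * b n t) holomorphic_on A" if t: "t \<in> ball t0 d" for t
    proof -
      have "((\<lambda>s. a n s * b n t) has_field_derivative deriv (a n) s * b n t) (at s)"
        if "s \<in> A" for n s
        using holomorphic_derivI[OF a \<open>open A\<close> that] by (auto intro!: derivative_eq_intros)
      moreover have "\<forall>\<^sub>F n in sequentially. \<forall>s\<in>A. norm (a n s * b n t) \<le> M n"
        using bound t sub by (auto elim!: eventually_mono)
      ultimately obtain g g' where
        "\<forall>s\<in>A. (\<lambda>n. a n s * b n t) sums g s \<and> (\<lambda>n. deriv (a n) s * b n t) sums g' s \<and>
           (g has_field_derivative g' s) (at s)"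
        by (rule series_and_derivative_comparison[OF \<open>open A\<close> M])
      then have "g holomorphic_on A" "\<forall>s\<in>A. (\<Sum>n. a n s * b n t) = g s"
        using \<open>open A\<close> by (auto simp: holomorphic_on_open sums_iff)
      then show ?thesis by (simp cong: holomorphic_cong)
    qed
    show "((\<lambda>t. \<Sum>n. a n s * b n t) has_field_derivative f' s t) (at t)"
      if s: "s \<in> A" and t: "t \<in> ball t0 d" for s t
    proof -
      have "((\<lambda>t. a n s * b n t) has_field_derivative a n s * deriv (b n) t) (at t)"
        if "t \<in> B" for n t
        using holomorphic_derivI[OF b \<open>open B\<close> that] by (auto intro!: derivative_eq_intros)
      moreover have "\<forall>\<^sub>F n in sequentially. \<forall>t\<in>B. norm (a n s * b n t) \<le> M n"
        using bound s by (auto elim!: eventually_mono)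
      ultimately obtain g g' where
        g: "\<forall>t\<in>B. (\<lambda>n. a n s * b n t) sums g t \<and> (\<lambda>n. a n s * deriv (b n) t) sums g' t \<and>
           (g has_field_derivative g' t) (at t)"
        by (rule series_and_derivative_comparison[OF \<open>open B\<close> M])
      then have "(g has_field_derivative f' s t) (at t)"
        using t sub by (auto simp: f'_def sums_iff)
      then show ?thesis
        by (rule has_field_derivative_transform_within_open[OF _ \<open>open B\<close>]) (use g t sub in \<open>auto simp: sums_iff\<close>)
    qed
    show "continuous_on (A \<times> ball t0 d) (\<lambda>(s, t). f' s t)"
    proof -
      have "norm (a n s * deriv (b n) t) \<le> M n / d"
        if n: "\<forall>s\<in>A. \<forall>t\<in>B. norm (a n s * b n t) \<le> M n" and s: "s \<in> A" and t: "t \<in> ball t0 d"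
        for n s t
      proof -
        have cb: "cball t d \<subseteq> B"
        proof
          fix x assume "x \<in> cball t d"
          then have "dist t0 x < 2 * d"
            using t dist_triangle[of t0 x t] by simp
          then show "x \<in> B" using d by auto
        qed
        have hol: "(\<lambda>t. a n s * b n t) holomorphic_on B"
          by (intro holomorphic_intros b)
        have "norm ((deriv ^^ 1) (\<lambda>t. a n s * b n t) t) \<le> fact 1 * M n / d ^ 1"
        proof (rule Cauchy_inequality)
          show "(\<lambda>t. a n s * b n t) holomorphic_on ball t d"
            using hol cb by (meson ball_subset_cball holomorphic_on_subset)
          show "continuous_on (cball t d) (\<lambda>t. a n s * b n t)"
            using hol cb by (meson holomorphic_on_imp_continuous_on holomorphic_on_subset)
          show "norm (a n s * b n x) \<le> M n" if "norm (t - x) = d" for x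
            using n s cb that by (auto simp: dist_norm)
        qed (use d in auto)
        moreover have "t \<in> B" using cb d by auto
        then have "b n field_differentiable at t"
          using b \<open>open B\<close> holomorphic_on_imp_differentiable_at by blast
        then have "deriv (\<lambda>t. a n s * b n t) t = a n s * deriv (b n) t"
          by (rule deriv_cmult)
        ultimately show ?thesis by simp
      qed
      then have "\<forall>\<^sub>F n in sequentially. \<forall>p\<in>A \<times> ball t0 d.
          norm (a n (fst p) * deriv (b n) (snd p)) \<le> M n / d"
        using bound by (auto elim!: eventually_mono)
      then have "uniform_limit (A \<times> ball t0 d)
          (\<lambda>n p. \<Sum>i<n. a i (fst p) * deriv (b i) (snd p))
          (\<lambda>p. \<Sum>i. a i (fst p) * deriv (b i) (snd p)) sequentially"
        by (rule Weierstrass_m_test_ev) (intro summable_divide M)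
      moreover have "continuous_on (A \<times> ball t0 d) (\<lambda>p. a i (fst p) * deriv (b i) (snd p))" for i
      proof -
        have "deriv (b i) holomorphic_on ball t0 d"
          by (meson b holomorphic_deriv holomorphic_on_subset sub \<open>open B\<close>)
        then show ?thesis
          by (intro continuous_intros continuous_on_compose2[OF holomorphic_on_imp_continuous_on[OF a]]
              continuous_on_compose2[OF holomorphic_on_imp_continuous_on[of "deriv (b i)" "ball t0 d"]]) auto
      qed
      ultimately have "continuous_on (A \<times> ball t0 d) (\<lambda>p. \<Sum>i. a i (fst p) * deriv (b i) (snd p))"
        by (intro uniform_limit_theorem[rotated]) (auto intro!: always_eventually continuous_on_sum)
      then show ?thesis by (simp add: f'_def case_prod_unfold)
    qed
  qed (use \<open>open A\<close> in auto)
  note local = this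
  show ?thesis
    unfolding holomorphic2_on_def
  proof
    fix p assume "p \<in> A \<times> B"
    then obtain s t where p: "p = (s, t)" "s \<in> A" "t \<in> B" by auto
    obtain e where e: "e > 0" "ball t e \<subseteq> B" using p(3) \<open>open B\<close> openE by blast
    then have "p \<in> A \<times> ball t (e / 2)" using p by auto
    moreover have "(\<lambda>(s, t). \<Sum>n. a n s * b n t) holomorphic2_on A \<times> ball t (e / 2)"
      using e by (intro local) auto
    ultimately show "\<exists>u v. ((\<lambda>(s, t). \<Sum>n. a n s * b n t) has_derivative
        (\<lambda>(x, y). u * x + v * y)) (at p)"
      unfolding holomorphic2_on_def by blast
  qed
qed

lemma holomorphic2_on_subset: "F holomorphic2_on U \<Longrightarrow> V \<subseteq> U \<Longrightarrow> F holomorphic2_on V"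
  unfolding holomorphic2_on_def by blast

lemma holomorphic2_on_fst:
  assumes "f holomorphic_on A" "open A"
  shows "(\<lambda>(s, t). f s) holomorphic2_on A \<times> B"
  unfolding holomorphic2_on_def
proof
  fix p assume p: "p \<in> A \<times> B"
  then have "(f has_derivative (*) (deriv f (fst p))) (at (fst p))"
    using assms holomorphic_derivI has_field_derivative_imp_has_derivative by fastforce
  then have "(f \<circ> fst has_derivative (*) (deriv f (fst p)) \<circ> fst) (at p)"
    by (intro diff_chain_at has_derivative_fst has_derivative_ident)
  then show "\<exists>a b. ((\<lambda>(s, t). f s) has_derivative (\<lambda>(u, v). a * u + b * v)) (at p)"
    by (intro exI[of _ "deriv f (fst p)"] exI[of _ 0]) (simp add: o_def case_prod_unfold)
qed

lemma holomorphic2_on_snd: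
  assumes "f holomorphic_on B" "open B"
  shows "(\<lambda>(s, t). f t) holomorphic2_on A \<times> B"
  unfolding holomorphic2_on_def
proof
  fix p assume p: "p \<in> A \<times> B"
  then have "(f has_derivative (*) (deriv f (snd p))) (at (snd p))"
    using assms holomorphic_derivI has_field_derivative_imp_has_derivative by fastforce
  then have "(f \<circ> snd has_derivative (*) (deriv f (snd p)) \<circ> snd) (at p)"
    by (intro diff_chain_at has_derivative_snd has_derivative_ident)
  then show "\<exists>a b. ((\<lambda>(s, t). f t) has_derivative (\<lambda>(u, v). a * u + b * v)) (at p)"
    by (intro exI[of _ 0] exI[of _ "deriv f (snd p)"]) (simp add: o_def case_prod_unfold)
qed

lemma holomorphic2_on_add:
  assumes "(\<lambda>(s, t). f s t) holomorphic2_on U" "(\<lambda>(s, t). g s t) holomorphic2_on U"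
  shows "(\<lambda>(s, t). f s t + g s t) holomorphic2_on U"
  unfolding holomorphic2_on_def
proof
  fix p assume "p \<in> U"
  then obtain a b c d where
    "((\<lambda>(s, t). f s t) has_derivative (\<lambda>(u, v). a * u + b * v)) (at p)"
    "((\<lambda>(s, t). g s t) has_derivative (\<lambda>(u, v). c * u + d * v)) (at p)"
    using assms unfolding holomorphic2_on_def by blast
  from has_derivative_add[OF this]
  show "\<exists>a b. ((\<lambda>(s, t). f s t + g s t) has_derivative (\<lambda>(u, v). a * u + b * v)) (at p)"
    by (intro exI[of _ "a + c"] exI[of _ "b + d"]) (simp add: case_prod_unfold algebra_simps)
qed

lemma holomorphic2_on_mult:
  assumes "(\<lambda>(s, t). f s t) holomorphic2_on U" "(\<lambda>(s, t). g s t) holomorphic2_on U"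
  shows "(\<lambda>(s, t). f s t * g s t) holomorphic2_on U"
  unfolding holomorphic2_on_def
proof
  fix p assume "p \<in> U"
  then obtain a b c d where
    "((\<lambda>(s, t). f s t) has_derivative (\<lambda>(u, v). a * u + b * v)) (at p)"
    "((\<lambda>(s, t). g s t) has_derivative (\<lambda>(u, v). c * u + d * v)) (at p)"
    using assms unfolding holomorphic2_on_def by blast
  from has_derivative_mult[OF this]
  show "\<exists>a b. ((\<lambda>(s, t). f s t * g s t) has_derivative (\<lambda>(u, v). a * u + b * v)) (at p)"
    by (intro exI[of _ "f (fst p) (snd p) * c + a * g (fst p) (snd p)"]
        exI[of _ "f (fst p) (snd p) * d + b * g (fst p) (snd p)"])
       (simp add: case_prod_unfold algebra_simps)
qed

section \<open>Rising binomial coefficients and the binomial series\<close>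

text \<open>This is the coefficient of \<open>z ^ r\<close> in the expansion of
  \<open>(1 - z) powr (- s)\<close>, a polynomial in \<open>s\<close> of degree
  \<open>r\<close>.\<close>

definition fq_coeff :: "nat \<Rightarrow> complex \<Rightarrow> complex" where
  "fq_coeff r s = (s + of_nat r - 1) gchoose r"

lemma fq_coeff_pochhammer: "fq_coeff r s = pochhammer s r / fact r"
  by (simp add: fq_coeff_def gbinomial_pochhammer')

lemma fq_coeff_holomorphic [holomorphic_intros]: "fq_coeff r holomorphic_on A"
  unfolding fq_coeff_pochhammer[abs_def] pochhammer_prod
  by (intro holomorphic_intros) auto

text \<open>The roots of the rising factorial are real. Non-real \<open>s\<close> thus give points
  of a polar hyperplane at which the singular term really is singular.\<close>

lemma fq_coeff_nonzero: "s \<notin> \<real> \<Longrightarrow> fq_coeff r s \<noteq> 0"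
  by (auto simp: fq_coeff_pochhammer pochhammer_eq_0_iff)

text \<open>The triangle inequality is applied to each factor \<open>s + i\<close> of the rising
  factorial. The bound is again a rising binomial coefficient, so the real binomial series can serve
  as majorant for all \<open>s\<close> in a disc.\<close>

lemma norm_fq_coeff_le:
  assumes "norm s \<le> S"
  shows "norm (fq_coeff r s) \<le> (S + of_nat r - 1) gchoose r"
proof -
  have "norm (pochhammer s r) \<le> pochhammer S r"
    unfolding pochhammer_prod prod_norm[symmetric]
  proof (rule prod_mono)
    fix i
    have "norm (s + of_nat i) \<le> norm s + norm (of_nat i :: complex)" by (rule norm_triangle_ineq)
    then show "0 \<le> norm (s + of_nat i) \<and> norm (s + of_nat i) \<le> S + of_nat i"
      using assms by simp
  qed
  then show ?thesis
    by (simp add: fq_coeff_pochhammer gbinomial_pochhammer' norm_divide divide_right_mono)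
qed

text \<open>This is the binomial series for exponent \<open>- s\<close> taken at \<open>- z\<close>;
  the sign \<open>(- 1) ^ r\<close> of the coefficient cancels against
  \<open>(- z) ^ r\<close>.\<close>

lemma rising_binomial_sums:
  assumes "norm (z :: complex) < 1"
  shows "(\<lambda>r. fq_coeff r s * z ^ r) sums (1 - z) powr (- s)"
proof -
  have "(- 1) ^ r * fq_coeff r s * (- z) ^ r = fq_coeff r s * z ^ r" for r
    by (simp add: power_minus[of z])
  moreover have "(\<lambda>r. (- 1) ^ r * fq_coeff r s * (- z) ^ r) sums (1 - z) powr (- s)"
    using one_plus_neg_powr_powser[of "- z" s] assms by (simp add: fq_coeff_def)
  ultimately show ?thesis by (simp only:)
qed

lemma summable_rising_binomial:
  assumes "\<bar>x\<bar> < (1 :: real)"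
  shows "summable (\<lambda>r. ((S + of_nat r - 1) gchoose r) * x ^ r)"
proof -
  have "(\<lambda>r. ((- S) gchoose r) * (- x) ^ r) sums (1 + - x) powr (- S)"
    by (rule gen_binomial_real) (use assms in simp)
  moreover have "((- S) gchoose r) * (- x) ^ r = ((S + of_nat r - 1) gchoose r) * x ^ r" for r
    by (simp add: gbinomial_minus power_minus[of x])
  ultimately show ?thesis
    by (simp add: sums_iff)
qed

section \<open>Powers of q and the location of the poles\<close>

lemma norm_q_powr:
  "0 < q \<Longrightarrow> norm (complex_of_real q powr w) = q powr Re w"
  by (simp add: norm_powr_real_powr)

lemma q_powr_eq_1_imp_Re_0:
  assumes "0 < q" "q < 1" and "complex_of_real q powr w = 1"
  shows "Re w = 0"
proof -
  have "q powr Re w = 1"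
    using norm_q_powr[of q w] assms by simp
  then show ?thesis using assms by (simp add: powr_def)
qed

lemma q_powr_eq_1_iff:
  assumes "0 < q" "q < 1"
  shows "complex_of_real q powr w = 1 \<longleftrightarrow> (\<exists>b::int. w = 2 * of_real pi * \<i> * of_int b / of_real (ln q))"
proof -
  have "ln q \<noteq> 0" using assms by simp
  have "complex_of_real q powr w = exp (w * of_real (ln q))"
    using assms by (simp add: powr_def Ln_of_real)
  also have "\<dots> = 1 \<longleftrightarrow> (\<exists>b::int. w * of_real (ln q) = of_int (2 * b) * pi * \<i>)"
    unfolding exp_eq_1 by (auto simp: complex_eq_iff)
  also have "\<dots> \<longleftrightarrow> (\<exists>b::int. w = 2 * of_real pi * \<i> * of_int b / of_real (ln q))"
    using \<open>ln q \<noteq> 0\<close> by (simp add: field_simps)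
  finally show ?thesis .
qed

text \<open>A point with real part \<open>a\<close> in the pole set makes the term of index
  \<open>r = - a\<close> singular, and \<open>a <= 0\<close> says exactly that this index is a
  natural number.\<close>

lemma mem_fq_poles_iff:
  assumes "0 < q" "q < 1"
  shows "t \<in> fq_poles q \<longleftrightarrow> (\<exists>r::nat. complex_of_real q powr (t + of_nat r) = 1)"
proof
  assume "t \<in> fq_poles q"
  then obtain a b :: int where
    *: "t = of_int a + 2 * of_real pi * \<i> * of_int b / of_real (ln q)" "a \<le> 0"
    by (auto simp: fq_poles_def)
  have "t + of_nat (nat (- a)) = 2 * of_real pi * \<i> * of_int b / of_real (ln q)"
    using * by simp
  then show "\<exists>r::nat. complex_of_real q powr (t + of_nat r) = 1"
    unfolding q_powr_eq_1_iff[OF assms] by blast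
next
  assume "\<exists>r::nat. complex_of_real q powr (t + of_nat r) = 1"
  then obtain r :: nat and b :: int where
    "t + of_nat r = 2 * of_real pi * \<i> * of_int b / of_real (ln q)"
    unfolding q_powr_eq_1_iff[OF assms] by blast
  then have "t = of_int (- int r) + 2 * of_real pi * \<i> * of_int b / of_real (ln q)"
    by (simp add: eq_diff_eq)
  then show "t \<in> fq_poles q"
    unfolding fq_poles_def by (intro CollectI exI[of _ "- int r"] exI[of _ b]) auto
qed

text \<open>A singular term of index \<open>r\<close> forces \<open>Re t = - r\<close>, which
  determines \<open>r\<close>. The term \<open>r0\<close> is not claimed to be singular, so the
  statement covers polar and regular \<open>t\<close> alike.\<close>

lemma ex_unique_polar_index:
  assumes "0 < q" "q < 1"
  shows "\<exists>r0::nat. \<forall>r. r \<noteq> r0 \<longrightarrow> complex_of_real q powr (t + of_nat r) \<noteq> 1"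
proof -
  have "Re t + real r = 0" if "complex_of_real q powr (t + of_nat r) = 1" for r
    using q_powr_eq_1_imp_Re_0[OF assms that] by simp
  then have "r = r'" if "complex_of_real q powr (t + of_nat r) = 1"
    "complex_of_real q powr (t + of_nat r') = 1" for r r'
    using that by (metis add_left_cancel of_nat_eq_iff)
  then show ?thesis by blast
qed

section \<open>Locally uniform convergence of the continued series\<close>

text \<open>The quantity \<open>q powr (- T) * q ^ r\<close> bounds the modulus of
  \<open>q powr (t + r)\<close>. Once it is at most 1/2, the denominator has modulus at least 1/2,
  whence the factor 2.\<close>

lemma norm_fq_cont_term_le:
  assumes "0 < q" "norm s \<le> S" "- T \<le> Re t" "q powr (- T) * q ^ r \<le> 1 / 2" "q < 1"
  shows "norm (fq_cont_term q s t r) \<le> 2 * q powr (- T) * (((S + of_nat r - 1) gchoose r) * q ^ r)"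
proof -
  let ?x = "complex_of_real q powr (t + of_nat r)"
  have "norm ?x = q powr (Re t + real r)"
    using norm_q_powr[of q "t + of_nat r"] assms by simp
  also have "\<dots> \<le> q powr (- T + real r)"
    using assms by (intro powr_mono') auto
  also have "\<dots> = q powr (- T) * q ^ r"
    using assms by (simp only: powr_add powr_realpow)
  finally have x: "norm ?x \<le> q powr (- T) * q ^ r" .
  have "norm (1 - ?x) \<ge> 1 / 2"
    using norm_triangle_ineq2[of 1 ?x] x assms by simp
  then have "norm (?x / (1 - ?x)) \<le> (q powr (- T) * q ^ r) / (1 / 2)"
    unfolding norm_divide using x assms(1) by (intro frac_le) auto
  then have "norm (fq_coeff r s) * norm (?x / (1 - ?x)) \<le>
      ((S + of_nat r - 1) gchoose r) * ((q powr (- T) * q ^ r) / (1 / 2))"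
    using norm_fq_coeff_le[OF assms(2)] by (intro mult_mono) (auto intro: order_trans[OF norm_ge_zero])
  then show ?thesis
    unfolding fq_cont_term_def fq_coeff_def[symmetric] norm_mult by (simp add: mult_ac)
qed

text \<open>The index from which the bound holds depends only on \<open>q\<close> and
  \<open>T\<close>, so it is uniform in \<open>s\<close> and \<open>t\<close>.\<close>

lemma eventually_norm_fq_cont_term_le:
  assumes "0 < q" "q < 1"
  shows "\<forall>\<^sub>F r in sequentially. \<forall>s t. norm s \<le> S \<longrightarrow> - T \<le> Re t \<longrightarrow>
    norm (fq_cont_term q s t r) \<le> 2 * q powr (- T) * (((S + of_nat r - 1) gchoose r) * q ^ r)"
proof -
  have "(\<lambda>r. q powr (- T) * q ^ r) \<longlonglongrightarrow> q powr (- T) * 0"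
    using assms by (intro tendsto_intros LIMSEQ_realpow_zero) auto
  then have "\<forall>\<^sub>F r in sequentially. q powr (- T) * q ^ r < 1 / 2"
    by (rule order_tendstoD) simp
  then show ?thesis
    by eventually_elim (use assms norm_fq_cont_term_le in \<open>auto intro: less_imp_le\<close>)
qed

text \<open>This covers polar \<open>t\<close> too: the singular term has the default value 0, and a
  single term does not affect convergence.\<close>

lemma summable_norm_fq_cont_term:
  assumes "0 < q" "q < 1"
  shows "summable (\<lambda>r. norm (fq_cont_term q s t r))"
proof (rule summable_comparison_test_ev)
  show "\<forall>\<^sub>F r in sequentially. norm (norm (fq_cont_term q s t r)) \<le>
      2 * q powr (Re t) * (((norm s + of_nat r - 1) gchoose r) * q ^ r)"
    using eventually_norm_fq_cont_term_le[OF assms, of "norm s" "- Re t"]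
    by (auto elim!: eventually_mono)
  show "summable (\<lambda>r. 2 * q powr (Re t) * (((norm s + of_nat r - 1) gchoose r) * q ^ r))"
    using assms by (intro summable_mult summable_rising_binomial) auto
qed

section \<open>Isolating the one singular term\<close>

text \<open>The term \<open>r0\<close> is set to 0 rather than skipped, so that the indices keep
  their positions and the series can be compared termwise with the full one.\<close>

definition fq_regular_part :: "real \<Rightarrow> nat \<Rightarrow> complex \<Rightarrow> complex \<Rightarrow> complex" where
  "fq_regular_part q r0 s t = (\<Sum>r. if r = r0 then 0 else fq_cont_term q s t r)"

text \<open>The identity holds even on the polar hyperplanes, because the split-off term carries the
  same default value on both sides.\<close>

lemma fq_cont_split:
  assumes "0 < q" "q < 1"
  shows "fq_cont q (s, t) = of_real (1 - q) powr s * (fq_coeff r0 s *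
    (of_real q powr (t + of_nat r0) / (1 - of_real q powr (t + of_nat r0))) + fq_regular_part q r0 s t)"
proof -
  have s: "summable (\<lambda>r. fq_cont_term q s t r)"
    by (rule summable_norm_cancel) (rule summable_norm_fq_cont_term[OF assms])
  have "(\<lambda>r. fq_cont_term q s t r - (if r = r0 then fq_cont_term q s t r else 0)) sums
      ((\<Sum>r. fq_cont_term q s t r) - fq_cont_term q s t r0)"
    by (intro sums_diff summable_sums s sums_single)
  also have "(\<lambda>r. fq_cont_term q s t r - (if r = r0 then fq_cont_term q s t r else 0)) =
      (\<lambda>r. if r = r0 then 0 else fq_cont_term q s t r)"
    by auto
  finally have "fq_regular_part q r0 s t = (\<Sum>r. fq_cont_term q s t r) - fq_cont_term q s t r0"
    by (simp add: fq_regular_part_def sums_iff)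
  then show ?thesis
    by (simp add: fq_cont_def fq_cont_term_def fq_coeff_def)
qed

lemma q_powr_holomorphic:
  assumes "0 < q"
  shows "(\<lambda>t. complex_of_real q powr (t + c)) holomorphic_on A"
  using assms by (intro holomorphic_intros) auto

text \<open>Only finitely many indices need continuity. Within distance 1 of \<open>t0\<close>,
  every \<open>r > N\<close> gives \<open>Re t + r > 0\<close>, so the power of \<open>q\<close> has
  modulus below 1; this explains the choice of \<open>N\<close>.\<close>

lemma ex_ball_without_poles:
  assumes q: "0 < q" "q < 1"
    and r0: "\<And>r. r \<noteq> r0 \<Longrightarrow> complex_of_real q powr (t0 + of_nat r) \<noteq> 1"
  shows "\<exists>d>0. \<forall>t\<in>ball t0 d. \<forall>r. r \<noteq> r0 \<longrightarrow> complex_of_real q powr (t + of_nat r) \<noteq> 1"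
proof -
  define N where "N = nat \<lceil>1 - Re t0\<rceil>"
  have "\<forall>\<^sub>F t in nhds t0. \<forall>r\<in>{..N} - {r0}. complex_of_real q powr (t + of_nat r) \<noteq> 1"
  proof (intro eventually_ball_finite ballI)
    fix r assume "r \<in> {..N} - {r0}"
    have "continuous_on UNIV (\<lambda>t. complex_of_real q powr (t + of_nat r))"
      using q by (intro holomorphic_on_imp_continuous_on q_powr_holomorphic)
    then have "open {t. complex_of_real q powr (t + of_nat r) \<noteq> 1}"
      by (intro open_Collect_neq continuous_on_const)
    moreover have "t0 \<in> {t. complex_of_real q powr (t + of_nat r) \<noteq> 1}"
      using r0 \<open>r \<in> _\<close> by auto
    ultimately show "\<forall>\<^sub>F t in nhds t0. complex_of_real q powr (t + of_nat r) \<noteq> 1"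
      using eventually_nhds by blast
  qed auto
  moreover have "\<forall>\<^sub>F t in nhds t0. dist t t0 < 1"
    by (auto simp: eventually_nhds_metric intro: exI[of _ 1])
  ultimately have "\<forall>\<^sub>F t in nhds t0. \<forall>r. r \<noteq> r0 \<longrightarrow> complex_of_real q powr (t + of_nat r) \<noteq> 1"
  proof (eventually_elim, intro allI impI)
    fix t r
    assume *: "\<forall>r\<in>{..N} - {r0}. complex_of_real q powr (t + of_nat r) \<noteq> 1" "dist t t0 < 1" "r \<noteq> r0"
    show "complex_of_real q powr (t + of_nat r) \<noteq> 1"
    proof (cases "r \<le> N")
      case False
      have "\<bar>Re t - Re t0\<bar> < 1"
        using abs_Re_le_cmod[of "t - t0"] *(2) by (simp add: dist_norm)
      moreover have "1 - Re t0 < real r" using False unfolding N_def by linarith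
      ultimately have "Re t + real r > 0" by linarith
      then have "q powr (Re t + real r) < 1"
        using q by (simp add: powr_def mult_pos_neg)
      then show ?thesis
        using norm_q_powr[of q "t + of_nat r"] q by auto
    qed (use * in auto)
  qed
  then show ?thesis
    unfolding eventually_nhds_metric by (auto simp: dist_commute)
qed

lemma fq_regular_part_holomorphic:
  assumes q: "0 < q" "q < 1"
    and "\<And>r t. r \<noteq> r0 \<Longrightarrow> t \<in> ball t0 d \<Longrightarrow> complex_of_real q powr (t + of_nat r) \<noteq> 1"
  shows "(\<lambda>(s, t). fq_regular_part q r0 s t) holomorphic2_on UNIV \<times> ball t0 d"
proof -
  define b where "b r t = (if r = r0 then 0 else
    complex_of_real q powr (t + of_nat r) / (1 - complex_of_real q powr (t + of_nat r)))" for r t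
  have term_eq: "fq_coeff r s * b r t = (if r = r0 then 0 else fq_cont_term q s t r)" for r s t
    by (simp add: b_def fq_cont_term_def fq_coeff_def)
  have "b r holomorphic_on ball t0 d" for r
  proof (cases "r = r0")
    case False
    have "(\<lambda>t. complex_of_real q powr (t + of_nat r) / (1 - complex_of_real q powr (t + of_nat r)))
        holomorphic_on ball t0 d"
    proof (intro holomorphic_on_divide holomorphic_on_diff q_powr_holomorphic holomorphic_on_const q)
      show "1 - complex_of_real q powr (t + of_nat r) \<noteq> 0" if "t \<in> ball t0 d" for t
        using assms(3)[OF False that] by simp
    qed
    then show ?thesis
      using False by (simp add: b_def[abs_def])
  qed (simp add: b_def[abs_def])
  \<comment> \<open>On the ball \<open>Re t\<close> is at least \<open>Re t0 - d\<close>, so the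
    earlier bound applies with \<open>T = d - Re t0\<close>. Indices beyond \<open>r0\<close> avoid
    the term that was replaced by 0.\<close>
  moreover have "\<forall>\<^sub>F r in sequentially. \<forall>s\<in>ball 0 S. \<forall>t\<in>ball t0 d.
      norm (fq_coeff r s * b r t) \<le>
      2 * q powr (- (d - Re t0)) * (((S + of_nat r - 1) gchoose r) * q ^ r)" for S
    using eventually_norm_fq_cont_term_le[OF q, of S "d - Re t0"] eventually_gt_at_top[of r0]
  proof eventually_elim
    case (elim r)
    have "- (d - Re t0) \<le> Re t" if "t \<in> ball t0 d" for t
      using that abs_Re_le_cmod[of "t0 - t"] by (simp add: dist_norm)
    then show ?case using elim by (auto simp: term_eq)
  qed
  ultimately have
    "(\<lambda>(s, t). \<Sum>r. fq_coeff r s * b r t) holomorphic2_on ball 0 S \<times> ball t0 d" for S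
    by (rule holomorphic2_on_suminf[OF open_ball open_ball fq_coeff_holomorphic])
      (use q in \<open>intro summable_mult summable_rising_binomial; simp\<close>)
  then have *: "(\<lambda>(s, t). fq_regular_part q r0 s t) holomorphic2_on ball 0 S \<times> ball t0 d" for S
    by (simp add: term_eq fq_regular_part_def)
  show ?thesis
    unfolding holomorphic2_on_def
  proof
    fix p :: "complex \<times> complex" assume "p \<in> UNIV \<times> ball t0 d"
    \<comment> \<open>The majorant requires bounded \<open>s\<close>, but differentiability is
      local, so a disc just large enough to contain the given \<open>s\<close> suffices.\<close>
    then have "p \<in> ball 0 (norm (fst p) + 1) \<times> ball t0 d" by (cases p) auto
    with * show "\<exists>u v. ((\<lambda>(s, t). fq_regular_part q r0 s t) has_derivative (\<lambda>(x, y). u * x + v * y)) (at p)"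
      unfolding holomorphic2_on_def by (rule bspec)
  qed
qed

section \<open>Agreement of the two series for Re t > 0\<close>

text \<open>All bases are positive reals because \<open>n > 0\<close>, so the complex power of the
  quotient \<open>(1 - q ^ n) / (1 - q)\<close> splits without branch corrections.\<close>

lemma fq_term_eq:
  assumes q: "0 < q" "q < 1" and "n > 0"
  shows "fq_term q s t n = of_real (1 - q) powr s *
    (of_real q powr (of_nat n * t) * (1 - of_real q ^ n) powr (- s))"
proof -
  have "q ^ n < 1" using q \<open>n > 0\<close> by (simp add: power_less_one_iff)
  have r: "of_real x powr s = exp (s * of_real (ln x))" if "x > 0" for x :: real and s :: complex
    using that by (simp add: powr_def Ln_of_real)
  have "complex_of_real (q_bracket q n) powr s =
      of_real (1 - q ^ n) powr s / of_real (1 - q) powr s"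
    using q \<open>q ^ n < 1\<close>
    by (simp only: q_bracket_def r diff_gt_0_iff_gt divide_pos_pos ln_divide_pos)
       (simp add: exp_diff algebra_simps)
  moreover have "of_real (1 - q ^ n) powr (- s) = 1 / complex_of_real (1 - q ^ n) powr s"
    by (simp add: powr_minus_divide)
  ultimately show ?thesis
    by (simp add: fq_term_def)
qed

text \<open>Both series are iterated sums of the family \<open>c r * x r ^ Suc n\<close>, up to the
  factor \<open>D\<close>: sums over \<open>n\<close> are geometric, sums over \<open>r\<close> are
  binomial. The exponent \<open>Suc n\<close> reflects the start at \<open>n = 1\<close>.\<close>

lemma fq_double_series:
  fixes s t :: complex
  assumes q: "0 < q" "q < 1" and t: "Re t > 0"
  shows "summable (\<lambda>n. norm (fq_term q s t (Suc n)))" and "fq q s t = fq_cont q (s, t)"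
proof -
  define x where "x r = complex_of_real q powr (t + of_nat r)" for r :: nat
  define c where "c r = fq_coeff r s" for r
  define D where "D = complex_of_real (1 - q) powr s"
  have D: "D \<noteq> 0" using q by (simp add: D_def)
  have norm_x: "norm (x r) = q powr (Re t + real r)" for r
    using norm_q_powr[of q "t + of_nat r"] q by (simp add: x_def)
  have x_lt_1: "norm (x r) < 1" for r
    using t q unfolding norm_x by (simp add: powr_def mult_pos_neg)
  have x_power: "x r ^ Suc n = of_real q powr (of_nat (Suc n) * t) * (of_real q ^ Suc n) ^ r" for r n
  proof -
    have "x r ^ Suc n = of_real q powr (of_nat (Suc n) * (t + of_nat r))"
      using q by (simp add: x_def powr_def mult.assoc flip: exp_of_nat_mult del: of_nat_Suc power_Suc)
    also have "\<dots> = of_real q powr (of_nat (Suc n) * t + of_nat (Suc n * r))"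
      by (simp add: algebra_simps)
    also have "\<dots> = of_real q powr (of_nat (Suc n) * t) * of_real q powr of_nat (Suc n * r)"
      by (rule powr_add)
    also have "complex_of_real q powr of_nat (Suc n * r) = of_real q ^ (Suc n * r)"
      using q unfolding powr_nat by simp
    finally show ?thesis by (simp only: power_mult)
  qed
  have geo: "((\<lambda>n. c r * x r ^ Suc n) has_sum fq_cont_term q s t r) UNIV"
    and geo_norm: "((\<lambda>n. norm (c r * x r ^ Suc n)) has_sum norm (c r) * (norm (x r) / (1 - norm (x r)))) UNIV" for r
  proof -
    have "(\<lambda>n. c r * (x r * x r ^ n)) sums (c r * (x r * (1 / (1 - x r))))"
      by (intro sums_mult geometric_sums x_lt_1)
    moreover have "(\<lambda>n. norm (c r) * (norm (x r) * norm (x r) ^ n)) sums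
        (norm (c r) * (norm (x r) * (1 / (1 - norm (x r)))))"
      by (intro sums_mult geometric_sums) (use x_lt_1 in simp)
    ultimately show "((\<lambda>n. c r * x r ^ Suc n) has_sum fq_cont_term q s t r) UNIV"
      and "((\<lambda>n. norm (c r * x r ^ Suc n)) has_sum norm (c r) * (norm (x r) / (1 - norm (x r)))) UNIV"
      by (auto intro!: norm_summable_imp_has_sum
          simp: fq_cont_term_def c_def fq_coeff_def x_def norm_mult norm_power sums_iff)
  qed
  \<comment> \<open>Absolute convergence of the double family is read off the continued series at
    the real point \<open>Re t\<close>: there the power of \<open>q\<close> equals
    \<open>norm (x r)\<close>, so the norms of the terms are exactly the sums over \<open>n\<close>
    of the norms of the family.\<close>
  have "(\<lambda>r. norm (fq_cont_term q s (of_real (Re t)) r)) summable_on UNIV"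
    using summable_norm_fq_cont_term[OF q] by (simp add: summable_on_UNIV_nonneg_real_iff)
  moreover have "norm (fq_cont_term q s (of_real (Re t)) r) = norm (c r) * (norm (x r) / (1 - norm (x r)))" for r
  proof -
    have "complex_of_real q powr (of_real (Re t) + of_nat r) = of_real (norm (x r))"
      unfolding norm_x using q by (simp flip: powr_of_real)
    moreover have "norm (1 - complex_of_real (norm (x r))) = 1 - norm (x r)"
      using x_lt_1[of r] by (metis abs_of_pos diff_gt_0_iff_gt norm_of_real of_real_1 of_real_diff)
    ultimately show ?thesis
      by (simp add: fq_cont_term_def c_def fq_coeff_def norm_mult norm_divide)
  qed
  ultimately have "(\<lambda>r. norm (c r) * (norm (x r) / (1 - norm (x r)))) summable_on UNIV"
    by simp
  then have "(\<lambda>p. norm (case p of (r, n) \<Rightarrow> c r * x r ^ Suc n)) summable_on UNIV \<times> UNIV"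
    using geo_norm by (intro summable_on_SigmaI[where g = "\<lambda>r. norm (c r) * (norm (x r) / (1 - norm (x r)))"]) auto
  then have sm: "(\<lambda>(r, n). c r * x r ^ Suc n) summable_on UNIV \<times> UNIV"
    by (rule abs_summable_summable)
  have sm': "(\<lambda>(n, r). c r * x r ^ Suc n) summable_on UNIV \<times> UNIV"
    using sm summable_on_swap[of "\<lambda>(r, n). c r * x r ^ Suc n" UNIV UNIV] by simp
  \<comment> \<open>For fixed \<open>n\<close> the factorisation \<open>x_power\<close> exhibits the
    binomial series at \<open>z = q ^ Suc n\<close>; division by \<open>D\<close> removes the
    prefactor \<open>(1 - q) powr s\<close>.\<close>
  have col: "(\<Sum>\<^sub>\<infinity>r. c r * x r ^ Suc n) = fq_term q s t (Suc n) / D" for n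
  proof -
    have "(\<lambda>r. c r * x r ^ Suc n) summable_on UNIV"
      using summable_on_SigmaD1[OF sm', of n] by simp
    then have "(\<lambda>r. c r * x r ^ Suc n) sums (\<Sum>\<^sub>\<infinity>r. c r * x r ^ Suc n)"
      by (intro has_sum_imp_sums has_sum_infsum)
    moreover have "norm (complex_of_real q ^ Suc n) < 1"
      using q unfolding norm_power by (simp add: power_less_one_iff del: power_Suc)
    then have "(\<lambda>r. of_real q powr (of_nat (Suc n) * t) * (c r * (of_real q ^ Suc n) ^ r)) sums
        (of_real q powr (of_nat (Suc n) * t) * (1 - of_real q ^ Suc n) powr (- s))"
      unfolding c_def by (intro sums_mult rising_binomial_sums)
    then have "(\<lambda>r. c r * x r ^ Suc n) sums
        (of_real q powr (of_nat (Suc n) * t) * (1 - of_real q ^ Suc n) powr (- s))"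
      unfolding x_power by (simp only: mult_ac)
    ultimately have "(\<Sum>\<^sub>\<infinity>r. c r * x r ^ Suc n) =
        of_real q powr (of_nat (Suc n) * t) * (1 - of_real q ^ Suc n) powr (- s)"
      by (rule sums_unique2)
    then show ?thesis
      using fq_term_eq[OF q, of "Suc n" s t] D by (simp add: D_def)
  qed
  have "(\<lambda>n. \<Sum>\<^sub>\<infinity>r. c r * x r ^ Suc n) summable_on UNIV"
    using summable_on_Sigma_banach[OF sm'] by simp
  then have "(\<lambda>n. D * (fq_term q s t (Suc n) / D)) summable_on UNIV"
    unfolding col by (rule summable_on_cmult_right)
  then have sumn: "(\<lambda>n. fq_term q s t (Suc n)) summable_on UNIV"
    using D by simp
  \<comment> \<open>Unordered summability of complex numbers is already absolute, so the first claim
    comes out of the double series as well.\<close>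
  then have "(\<lambda>n. norm (fq_term q s t (Suc n))) summable_on UNIV"
    by (rule summable_on_iff_abs_summable_on_complex[THEN iffD1])
  then show "summable (\<lambda>n. norm (fq_term q s t (Suc n)))"
    by (rule summable_on_imp_summable)
  have "fq q s t = (\<Sum>\<^sub>\<infinity>n. fq_term q s t (Suc n))"
    unfolding fq_def using has_sum_imp_sums[OF has_sum_infsum[OF sumn]] by (simp add: sums_iff)
  also have "\<dots> = (\<Sum>\<^sub>\<infinity>n. D * (fq_term q s t (Suc n) / D))"
    using D by simp
  also have "\<dots> = D * (\<Sum>\<^sub>\<infinity>n. \<Sum>\<^sub>\<infinity>r. c r * x r ^ Suc n)"
    unfolding col by (rule infsum_cmult_right')
  also have "(\<Sum>\<^sub>\<infinity>n. \<Sum>\<^sub>\<infinity>r. c r * x r ^ Suc n) = (\<Sum>\<^sub>\<infinity>r. \<Sum>\<^sub>\<infinity>n. c r * x r ^ Suc n)"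
    by (rule infsum_swap_banach[OF sm'])
  also have "\<dots> = (\<Sum>\<^sub>\<infinity>r. fq_cont_term q s t r)"
    by (simp only: infsumI[OF geo])
  also have "\<dots> = (\<Sum>r. fq_cont_term q s t r)"
    using norm_summable_imp_has_sum[OF summable_norm_fq_cont_term[OF q]
        summable_sums[OF summable_norm_cancel[OF summable_norm_fq_cont_term[OF q]]]]
    by (rule infsumI)
  finally show "fq q s t = fq_cont q (s, t)"
    by (simp add: fq_cont_def D_def)
qed

section \<open>Meromorphy, holomorphy off the poles, and pole order\<close>

text \<open>Near \<open>t0\<close> only the denominator \<open>1 - q powr (t + r0)\<close> can
  vanish; multiplying by it yields a holomorphic numerator for all \<open>s\<close>.\<close>

lemma fq_cont_meromorphic:
  assumes q: "0 < q" "q < 1"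
  shows "fq_cont q meromorphic2_on UNIV"
  unfolding meromorphic2_on_def
proof
  fix p :: "complex \<times> complex"
  obtain s0 t0 where p: "p = (s0, t0)" by (cases p)
  obtain r0 where "\<And>r. r \<noteq> r0 \<Longrightarrow> complex_of_real q powr (t0 + of_nat r) \<noteq> 1"
    using ex_unique_polar_index[OF q] by metis
  from ex_ball_without_poles[OF q this] obtain d where d: "d > 0"
    "\<And>t r. t \<in> ball t0 d \<Longrightarrow> r \<noteq> r0 \<Longrightarrow> complex_of_real q powr (t + of_nat r) \<noteq> 1"
    by metis
  define V where "V = (UNIV :: complex set) \<times> ball t0 d"
  define E where "E t = complex_of_real q powr (t + of_nat r0)" for t
  define g where "g = (\<lambda>(s, t). of_real (1 - q) powr s *
    (fq_coeff r0 s * E t + (1 - E t) * fq_regular_part q r0 s t))"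
  define h where "h = (\<lambda>(s :: complex, t). 1 - E t)"
  show "\<exists>V g h. open V \<and> connected V \<and> p \<in> V \<and> V \<subseteq> UNIV \<and>
        g holomorphic2_on V \<and> h holomorphic2_on V \<and> (\<exists>z\<in>V. h z \<noteq> 0) \<and>
        (\<forall>z\<in>V. h z \<noteq> 0 \<longrightarrow> fq_cont q z = g z / h z)"
  proof (rule exI[of _ V], rule exI[of _ g], rule exI[of _ h], intro conjI)
    show "open V" "connected V" "p \<in> V"
      using d by (auto simp: V_def p intro: open_Times connected_Times)
    have E: "E holomorphic_on ball t0 d"
      unfolding E_def by (intro q_powr_holomorphic q)
    then show "h holomorphic2_on V"
      unfolding h_def V_def by (intro holomorphic2_on_snd holomorphic_intros) auto
    show "g holomorphic2_on V"
      unfolding g_def V_def using E d q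
      by (intro holomorphic2_on_mult holomorphic2_on_add fq_regular_part_holomorphic
          holomorphic2_on_snd[where f = E] holomorphic2_on_snd[where f = "\<lambda>t. 1 - E t"]
          holomorphic2_on_fst[where f = "fq_coeff r0"]
          holomorphic2_on_fst[where f = "\<lambda>s. of_real (1 - q) powr s"] holomorphic_intros) auto
    show "\<forall>z\<in>V. h z \<noteq> 0 \<longrightarrow> fq_cont q z = g z / h z"
      by (auto simp: h_def g_def fq_cont_split[OF q, where ?r0.0 = r0] E_def[symmetric] field_simps)
    show "\<exists>z\<in>V. h z \<noteq> 0"
    proof -
      \<comment> \<open>Zeros of \<open>1 - E\<close> lie on a single vertical line, so of two
        points with different real parts at most one is a zero.\<close>
      have "E t0 \<noteq> 1 \<or> E (t0 + of_real (d / 2)) \<noteq> 1"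
        using q_powr_eq_1_imp_Re_0[OF q, of "t0 + of_nat r0"]
          q_powr_eq_1_imp_Re_0[OF q, of "t0 + of_real (d / 2) + of_nat r0"] d(1)
        by (auto simp: E_def)
      moreover have "t0 \<in> ball t0 d" "t0 + of_real (d / 2) \<in> ball t0 d"
        using d(1) by (auto simp: dist_norm)
      ultimately obtain t where "t \<in> ball t0 d" "E t \<noteq> 1" by blast
      then have "(s0, t) \<in> V" "h (s0, t) \<noteq> 0" by (auto simp: V_def h_def)
      then show ?thesis by blast
    qed
  qed simp
qed


lemma fq_cont_holomorphic:
  assumes q: "0 < q" "q < 1"
  shows "fq_cont q holomorphic2_on {(s, t). t \<notin> fq_poles q}"
  unfolding holomorphic2_on_def
proof
  fix p :: "complex \<times> complex" assume "p \<in> {(s, t). t \<notin> fq_poles q}"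
  then obtain s0 t0 where p: "p = (s0, t0)" "\<And>r. complex_of_real q powr (t0 + of_nat r) \<noteq> 1"
    using mem_fq_poles_iff[OF q] by auto
  obtain d where d: "d > 0"
    "\<And>t r. t \<in> ball t0 d \<Longrightarrow> r \<noteq> 0 \<Longrightarrow> complex_of_real q powr (t + of_nat r) \<noteq> 1"
    using ex_ball_without_poles[OF q p(2), of 0] by metis
  \<comment> \<open>The ball lemma always exempts one index. Exempting first 0 and then 1 shows that
    no term at all is singular near \<open>t0\<close>.\<close>
  obtain e where e: "e > 0" "\<And>t. t \<in> ball t0 e \<Longrightarrow> complex_of_real q powr t \<noteq> 1"
    using ex_ball_without_poles[OF q p(2), of 1] by (metis add_0_right of_nat_0 zero_neq_one)
  define B where "B = ball t0 (min d e)"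
  have sub: "B \<subseteq> ball t0 d" by (auto simp: B_def)
  have E: "(\<lambda>t. complex_of_real q powr t / (1 - complex_of_real q powr t)) holomorphic_on B"
  proof (intro holomorphic_on_divide holomorphic_on_diff holomorphic_on_const)
    show "(\<lambda>t. complex_of_real q powr t) holomorphic_on B"
      using q_powr_holomorphic[OF q(1), of 0] by simp
    then show "(\<lambda>t. complex_of_real q powr t) holomorphic_on B" .
    show "1 - complex_of_real q powr t \<noteq> 0" if "t \<in> B" for t
      using e(2)[of t] that by (simp add: B_def)
  qed
  have "(\<lambda>(s, t). fq_regular_part q 0 s t) holomorphic2_on UNIV \<times> B"
    by (rule holomorphic2_on_subset[OF fq_regular_part_holomorphic[OF q d(2)]]) (use sub in auto)
  then have "(\<lambda>(s, t). of_real (1 - q) powr s * (fq_coeff 0 s *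
      (complex_of_real q powr t / (1 - complex_of_real q powr t)) + fq_regular_part q 0 s t))
      holomorphic2_on UNIV \<times> B"
    using q
    by (intro holomorphic2_on_mult holomorphic2_on_add holomorphic2_on_snd[OF E]
        holomorphic2_on_fst[where f = "fq_coeff 0"]
        holomorphic2_on_fst[where f = "\<lambda>s. of_real (1 - q) powr s"] holomorphic_intros)
      (auto simp: B_def)
  also have "(\<lambda>(s, t). of_real (1 - q) powr s * (fq_coeff 0 s *
      (complex_of_real q powr t / (1 - complex_of_real q powr t)) + fq_regular_part q 0 s t)) = fq_cont q"
    using fq_cont_split[OF q, where ?r0.0 = 0] by (auto simp: fun_eq_iff)
  finally show "\<exists>a b. (fq_cont q has_derivative (\<lambda>(u, v). a * u + b * v)) (at p)"
    using p d e unfolding holomorphic2_on_def by (auto simp: B_def)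
qed

text \<open>The denominator \<open>1 - E t\<close> has a simple zero at \<open>c\<close>, its
  derivative there being \<open>- ln q\<close>. Hence it equals \<open>(t - c) * \<psi> t\<close>
  with \<open>\<psi> c\<close> nonzero, and \<open>\<psi>\<close> serves as the function
  \<open>h\<close> of the pole condition.\<close>

lemma fq_cont_pole_order:
  assumes q: "0 < q" "q < 1" and c: "c \<in> fq_poles q"
  shows "pole_of_order_along (fq_cont q) c 1"
  unfolding pole_of_order_along_def
proof
  fix s0
  obtain r0 where r0: "complex_of_real q powr (c + of_nat r0) = 1"
    using c mem_fq_poles_iff[OF q] by auto
  have "complex_of_real q powr (c + of_nat r) \<noteq> 1" if "r \<noteq> r0" for r
    using q_powr_eq_1_imp_Re_0[OF q r0] q_powr_eq_1_imp_Re_0[OF q, of "c + of_nat r"] that by auto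
  from ex_ball_without_poles[OF q this] obtain d where d: "d > 0"
    "\<And>t r. t \<in> ball c d \<Longrightarrow> r \<noteq> r0 \<Longrightarrow> complex_of_real q powr (t + of_nat r) \<noteq> 1"
    by metis
  define E where "E t = complex_of_real q powr (t + of_nat r0)" for t
  \<comment> \<open>This is the difference quotient with its removable singularity filled in; the
    term \<open>1 - E c\<close> is 0 and keeps the quotient in the form whose holomorphy is
    known.\<close>
  define \<psi> where "\<psi> t = (if t = c then deriv (\<lambda>t. 1 - E t) c else ((1 - E t) - (1 - E c)) / (t - c))" for t
  \<comment> \<open>At \<open>t = c\<close> the regular part drops out and \<open>E c = 1\<close>,
    leaving \<open>(1 - q) powr s * fq_coeff r0 s\<close>. This may vanish at individual
    \<open>s\<close>, but not on a whole disc.\<close>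
  define g where "g = (\<lambda>(s, t). of_real (1 - q) powr s *
    (fq_coeff r0 s * E t + (t - c) * \<psi> t * fq_regular_part q r0 s t))"
  have E: "E holomorphic_on A" for A
    unfolding E_def by (intro q_powr_holomorphic q)
  have "(\<lambda>t. 1 - E t) holomorphic_on UNIV"
    by (intro holomorphic_intros E)
  then have "\<psi> holomorphic_on UNIV"
    unfolding \<psi>_def by (intro pole_lemma_open) auto
  then have psi: "\<psi> holomorphic_on A" for A
    by (rule holomorphic_on_subset) simp
  have "(E has_field_derivative of_real (ln q) * E c) (at c)"
  proof -
    have "E = (\<lambda>t. exp ((t + of_nat r0) * of_real (ln q)))"
      using q by (simp add: E_def fun_eq_iff powr_def Ln_of_real)
    then show ?thesis by (auto intro!: derivative_eq_intros)
  qed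
  then have "((\<lambda>t. 1 - E t) has_field_derivative - of_real (ln q)) (at c)"
    using r0 by (auto intro!: derivative_eq_intros simp flip: E_def)
  then have psi_c: "\<psi> c \<noteq> 0"
    using q by (simp add: \<psi>_def DERIV_imp_deriv)
  have psi_E: "(t - c) * \<psi> t = 1 - E t" for t
    using r0 by (simp add: \<psi>_def E_def)
  show "\<exists>e>0. \<exists>g h.
        g holomorphic2_on (ball s0 e \<times> ball c e) \<and>
        h holomorphic2_on (ball s0 e \<times> ball c e) \<and>
        (\<exists>s\<in>ball s0 e. g (s, c) \<noteq> 0) \<and> (\<exists>s\<in>ball s0 e. h (s, c) \<noteq> 0) \<and>
        (\<forall>s\<in>ball s0 e. \<forall>t\<in>ball c e. t \<noteq> c \<longrightarrow> h (s, t) \<noteq> 0 \<longrightarrow>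
           fq_cont q (s, t) = g (s, t) / ((t - c) ^ 1 * h (s, t)))"
  proof (rule exI[of _ d], intro conjI d(1), rule exI[of _ g], rule exI[of _ "\<lambda>(s, t). \<psi> t"], intro conjI)
    show "(\<lambda>(s, t). \<psi> t) holomorphic2_on ball s0 d \<times> ball c d"
      by (intro holomorphic2_on_snd psi) auto
    have "g holomorphic2_on UNIV \<times> ball c d"
      unfolding g_def using E d q psi
      by (intro holomorphic2_on_mult holomorphic2_on_add fq_regular_part_holomorphic
          holomorphic2_on_snd[where f = E] holomorphic2_on_snd[where f = \<psi>]
          holomorphic2_on_snd[where f = "\<lambda>t. t - c"]
          holomorphic2_on_fst[where f = "fq_coeff r0"]
          holomorphic2_on_fst[where f = "\<lambda>s. of_real (1 - q) powr s"] holomorphic_intros) auto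
    then show "g holomorphic2_on ball s0 d \<times> ball c d"
      by (rule holomorphic2_on_subset) auto
    show "\<exists>s\<in>ball s0 d. g (s, c) \<noteq> 0"
    proof -
      \<comment> \<open>The zeros of the coefficient are non-positive integers, so any non-real \<open>s\<close> works.\<close>
      define s where "s = (if Im s0 = 0 then s0 + \<i> * of_real (d / 2) else s0)"
      have "s \<notin> \<real>" "s \<in> ball s0 d"
        using d(1) by (auto simp: s_def complex_is_Real_iff dist_norm norm_mult)
      then show ?thesis
        using q r0 by (intro bexI[of _ s]) (auto simp: g_def E_def fq_coeff_nonzero)
    qed
    show "\<exists>s\<in>ball s0 d. (\<lambda>(s, t). \<psi> t) (s, c) \<noteq> 0"
      using psi_c d(1) by (intro bexI[of _ s0]) auto
    show "\<forall>s\<in>ball s0 d. \<forall>t\<in>ball c d. t \<noteq> c \<longrightarrow> (\<lambda>(s, t). \<psi> t) (s, t) \<noteq> 0 \<longrightarrow>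
           fq_cont q (s, t) = g (s, t) / ((t - c) ^ 1 * (\<lambda>(s, t). \<psi> t) (s, t))"
    proof (intro ballI impI)
      fix s t :: complex assume "t \<noteq> c" "(\<lambda>(s, t). \<psi> t) (s, t) \<noteq> 0"
      then have "1 - E t \<noteq> 0" using psi_E[of t] by auto
      then show "fq_cont q (s, t) = g (s, t) / ((t - c) ^ 1 * (\<lambda>(s, t). \<psi> t) (s, t))"
        by (simp add: fq_cont_split[OF q, where ?r0.0 = r0] g_def psi_E flip: E_def)
          (simp add: field_simps)
    qed
  qed
qed


theorem proposition1:
  fixes q :: real
  assumes "0 < q" and "q < 1"
  shows "(\<forall>s t. Re t > 0 \<longrightarrow> summable (\<lambda>n. norm (fq_term q s t (Suc n)))) \<and>
         (\<forall>s t. t \<notin> fq_poles q \<longrightarrow> summable (\<lambda>r. fq_cont_term q s t r)) \<and>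
         (\<forall>s t. Re t > 0 \<longrightarrow> fq q s t = fq_cont q (s, t)) \<and>
         fq_cont q meromorphic2_on UNIV \<and>
         fq_cont q holomorphic2_on {(s, t). t \<notin> fq_poles q} \<and>
         (\<forall>c\<in>fq_poles q. pole_of_order_along (fq_cont q) c 1)"
  using fq_double_series[OF assms] summable_norm_cancel[OF summable_norm_fq_cont_term[OF assms]]
    fq_cont_meromorphic[OF assms] fq_cont_holomorphic[OF assms] fq_cont_pole_order[OF assms]
  by blast

end
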